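(* Let $G$ be a finite loopless $4$-regular planar graph (parallel edges allowed). Then $\mathrm{hn}_{cc}(G)\le \frac{1}{2}|V(G)|$. Furthermore, this bound is tight: there exists a loopless $4$-regular planar graph $G$ with $\mathrm{hn}_{cc}(G)=\frac{1}{2}|V(G)|$.
   Context: Graphs are finite and loopless, and may have parallel edges (the edge set is a multiset); the degree of a vertex counts edges with multiplicity, and $G$ is $4$-regular if every vertex has degree $4$. A cycle is a closed walk $(v_1,\dots,v_q,v_1)$ with at least one edge in which the only repeated vertex is $v_1$; in particular two distinct parallel edges between $u$ and $v$ form a cycle of length $2$. For $S\subseteq V(G)$ let $I_{cc}(S)=S\cup\{v\in V(G): \text{there is a cycle } C \text{ of } G \text{ with } V(C)\setminus S=\{v\}\}$. A set $S$ is convex if $I_{cc}(S)=S$. The convex hull $\mathrm{hull}(S)$ is the inclusion-wise smallest convex set containing $S$. $S$ is a hull set if $\mathrm{hull}(S)=V(G)$, and $\mathrm{hn}_{cc}(G)$ is the minimum cardinality of a hull set of $G$. *)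

theory Defs
  imports "HOL-Analysis.Analysis"
begin

text \<open>
  Parallel edges are modelled by edge names: two different names in \<open>edges G\<close> may have the same
  pair of ends. The condition \<open>card (ends G e) = 2\<close> excludes loops.
\<close>

record ('v, 'e) multigraph =
  verts :: "'v set"
  edges :: "'e set"
  ends :: "'e \<Rightarrow> 'v set"

definition loopless_multigraph :: "('v, 'e) multigraph \<Rightarrow> bool" where
  "loopless_multigraph G \<longleftrightarrow>
     finite (verts G) \<and> finite (edges G) \<and>
     (\<forall>e\<in>edges G. ends G e \<subseteq> verts G \<and> card (ends G e) = 2)"

definition degree :: "('v, 'e) multigraph \<Rightarrow> 'v \<Rightarrow> nat" where
  "degree G v = card {e \<in> edges G. v \<in> ends G e}"

definition regular :: "nat \<Rightarrow> ('v, 'e) multigraph \<Rightarrow> bool" where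
  "regular k G \<longleftrightarrow> (\<forall>v\<in>verts G. degree G v = k)"

text \<open>
  A drawing without crossings: vertices are distinct points, edges are simple arcs joining their
  ends, an arc passes through no other vertex, and two arcs meet only in common ends.
\<close>

definition plane_drawing ::
  "('v, 'e) multigraph \<Rightarrow> ('v \<Rightarrow> complex) \<Rightarrow> ('e \<Rightarrow> real \<Rightarrow> complex) \<Rightarrow> bool" where
  "plane_drawing G p \<gamma> \<longleftrightarrow>
     inj_on p (verts G) \<and>
     (\<forall>e\<in>edges G. arc (\<gamma> e) \<and> {pathstart (\<gamma> e), pathfinish (\<gamma> e)} = p ` ends G e) \<and>
     (\<forall>e\<in>edges G. \<forall>v\<in>verts G. p v \<in> path_image (\<gamma> e) \<longrightarrow> v \<in> ends G e) \<and>
     (\<forall>e\<in>edges G. \<forall>f\<in>edges G. e \<noteq> f \<longrightarrow>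
        path_image (\<gamma> e) \<inter> path_image (\<gamma> f) \<subseteq> p ` (ends G e \<inter> ends G f))"

definition planar :: "('v, 'e) multigraph \<Rightarrow> bool" where
  "planar G \<longleftrightarrow> (\<exists>p \<gamma>. plane_drawing G p \<gamma>)"

text \<open>
  The closed walk \<open>(v\<^sub>1, \<dots>, v\<^sub>q, v\<^sub>1)\<close> is given by the list \<open>vs\<close> of its vertices without the final
  repetition and the list \<open>es\<close> of its edges. Distinctness of \<open>es\<close> matters only for \<open>q = 2\<close>, where
  it rules out going back and forth along a single edge.
\<close>

definition is_cycle :: "('v, 'e) multigraph \<Rightarrow> 'v list \<Rightarrow> 'e list \<Rightarrow> bool" where
  "is_cycle G vs es \<longleftrightarrow>
     es \<noteq> [] \<and> length vs = length es \<and> distinct vs \<and> distinct es \<and>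
     set vs \<subseteq> verts G \<and> set es \<subseteq> edges G \<and>
     (\<forall>i<length es. ends G (es ! i) = {vs ! i, vs ! (Suc i mod length vs)})"

definition cc_interval :: "('v, 'e) multigraph \<Rightarrow> 'v set \<Rightarrow> 'v set" where
  "cc_interval G S = S \<union> {v \<in> verts G. \<exists>vs es. is_cycle G vs es \<and> set vs - S = {v}}"

definition cc_convex :: "('v, 'e) multigraph \<Rightarrow> 'v set \<Rightarrow> bool" where
  "cc_convex G S \<longleftrightarrow> S \<subseteq> verts G \<and> cc_interval G S = S"

definition cc_hull :: "('v, 'e) multigraph \<Rightarrow> 'v set \<Rightarrow> 'v set" where
  "cc_hull G S = cc_convex G hull S"

definition cc_hull_set :: "('v, 'e) multigraph \<Rightarrow> 'v set \<Rightarrow> bool" where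
  "cc_hull_set G S \<longleftrightarrow> S \<subseteq> verts G \<and> cc_hull G S = verts G"

definition cc_hull_number :: "('v, 'e) multigraph \<Rightarrow> nat" where
  "cc_hull_number G = Min (card ` {S. cc_hull_set G S})"

text \<open>
  The library operator \<open>hull\<close> is an intersection; here it is indeed the smallest convex superset,
  and the minimum above is attained.
\<close>

lemma cc_convex_verts: "cc_convex G (verts G)"
  unfolding cc_convex_def cc_interval_def by auto

lemma cc_convex_Inter:
  assumes "\<And>T. T \<in> \<F> \<Longrightarrow> cc_convex G T" and "\<F> \<noteq> {}"
  shows "cc_convex G (\<Inter>\<F>)"
proof -
  have "v \<in> T"
    if "v \<in> verts G" "is_cycle G vs es" "set vs - \<Inter>\<F> = {v}" "T \<in> \<F>" for v vs es T
  proof (rule ccontr)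
    assume "v \<notin> T"
    with that have "set vs - T = {v}" by blast
    with that have "v \<in> cc_interval G T" unfolding cc_interval_def by blast
    with assms(1)[OF \<open>T \<in> \<F>\<close>] \<open>v \<notin> T\<close> show False unfolding cc_convex_def by blast
  qed
  moreover have "\<Inter>\<F> \<subseteq> verts G"
    using assms unfolding cc_convex_def by blast
  ultimately show ?thesis
    unfolding cc_convex_def cc_interval_def by blast
qed

lemma cc_hull_least:
  assumes "S \<subseteq> verts G"
  shows "cc_convex G (cc_hull G S)" and "S \<subseteq> cc_hull G S"
    and "\<And>T. cc_convex G T \<Longrightarrow> S \<subseteq> T \<Longrightarrow> cc_hull G S \<subseteq> T"
proof -
  show "cc_convex G (cc_hull G S)"
    unfolding cc_hull_def hull_def
    using assms cc_convex_verts by (intro cc_convex_Inter) auto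
  show "S \<subseteq> cc_hull G S"
    unfolding cc_hull_def by (rule hull_subset)
  show "cc_hull G S \<subseteq> T" if "cc_convex G T" "S \<subseteq> T" for T
    unfolding cc_hull_def using that by (simp add: hull_minimal)
qed

lemma cc_hull_number_attained:
  assumes "finite (verts G)"
  shows "\<exists>S. cc_hull_set G S \<and> card S = cc_hull_number G"
    and "\<And>S. cc_hull_set G S \<Longrightarrow> cc_hull_number G \<le> card S"
proof -
  have fin: "finite {S. cc_hull_set G S}"
    using assms by (auto intro: finite_subset[of _ "Pow (verts G)"] simp: cc_hull_set_def)
  have "cc_hull_set G (verts G)"
    unfolding cc_hull_set_def cc_hull_def by (simp add: cc_convex_verts hull_same)
  then have "Min (card ` {S. cc_hull_set G S}) \<in> card ` {S. cc_hull_set G S}"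
    using fin by (intro Min_in) auto
  then show "\<exists>S. cc_hull_set G S \<and> card S = cc_hull_number G"
    unfolding cc_hull_number_def by auto
  show "cc_hull_number G \<le> card S" if "cc_hull_set G S" for S
    unfolding cc_hull_number_def using fin that by (intro Min_le) auto
qed

end

theory Submission
  imports Defs
begin

text \<open>
  Order the vertices so that every vertex except the last one of each component of \<open>G\<close> has a later
  neighbour, and let \<open>S\<close> consist of the vertices that close no cycle with earlier ones. A vertex
  that does close a cycle has two edges into one component of the preceding vertices, hence is
  absorbed by the hull; so \<open>S\<close> is a hull set. When \<open>v\<close> is added, the cycle rank of the graph
  induced so far grows by the number of edges back minus the number of components touched: by
  \<open>0\<close> for \<open>v \<in> S\<close>, otherwise by at most \<open>2\<close>, or \<open>3\<close> if \<open>v\<close> is last in its component. The total is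
  \<open>|E| - |V| + k = |V| + k\<close> for \<open>k\<close> components, so at least \<open>|V| / 2\<close> vertices are absorbed.
  Equality holds for two vertices joined by four parallel edges.
\<close>

section \<open>Connected vertex sets and components of induced subgraphs\<close>

definition adj_in :: "('v, 'e) multigraph \<Rightarrow> 'v set \<Rightarrow> ('v \<times> 'v) set" where
  "adj_in G C = {(x, y). x \<in> C \<and> y \<in> C \<and> (\<exists>e\<in>edges G. ends G e = {x, y})}"

definition connected_in :: "('v, 'e) multigraph \<Rightarrow> 'v set \<Rightarrow> bool" where
  "connected_in G C \<longleftrightarrow> C \<times> C \<subseteq> (adj_in G C)\<^sup>*"

text \<open>Edges range over all of \<open>G\<close>, so a nonempty component of the graph induced
  on some \<open>P\<close> has a boundary exactly when it is not yet a whole component of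
  \<open>G\<close>.\<close>

definition has_boundary :: "('v, 'e) multigraph \<Rightarrow> 'v set \<Rightarrow> bool" where
  "has_boundary G C \<longleftrightarrow> (\<exists>e\<in>edges G. ends G e \<inter> C \<noteq> {} \<and> \<not> ends G e \<subseteq> C)"

definition edges_within :: "('v, 'e) multigraph \<Rightarrow> 'v set \<Rightarrow> 'e set" where
  "edges_within G P = {e \<in> edges G. ends G e \<subseteq> P}"

text \<open>The empty set may be a member of \<C>; having no boundary, it never enters the count of
  components with boundary.\<close>

definition components_of :: "('v, 'e) multigraph \<Rightarrow> 'v set \<Rightarrow> 'v set set \<Rightarrow> bool" where
  "components_of G P \<C> \<longleftrightarrow>
     \<Union>\<C> = P \<and> disjoint \<C> \<and> (\<forall>C\<in>\<C>. connected_in G C) \<and>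
     (\<forall>e\<in>edges_within G P. \<exists>C\<in>\<C>. ends G e \<subseteq> C)"

lemma adj_in_mono: "C \<subseteq> D \<Longrightarrow> adj_in G C \<subseteq> adj_in G D"
  unfolding adj_in_def by blast

lemma sym_adj_in: "sym (adj_in G C)"
  unfolding adj_in_def sym_def by (auto simp: insert_commute)

lemma ends_eq_doubleton:
  assumes "loopless_multigraph G" "e \<in> edges G" "v \<in> ends G e"
  obtains u where "ends G e = {v, u}" "u \<noteq> v" "u \<in> verts G" "v \<in> verts G"
proof -
  have "card (ends G e) = 2" "ends G e \<subseteq> verts G"
    using assms(1,2) unfolding loopless_multigraph_def by auto
  then show ?thesis
    using assms(3) that unfolding card_2_iff
    by (metis doubleton_eq_iff insert_iff insert_subset singletonD)
qed

section \<open>Paths inside a connected set and the cycles they close\<close>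

text \<open>A walk is shortened while it is built from its end: if the vertex to be prepended
  already lies on the path, the part before it is dropped.\<close>

lemma adj_in_simple_path:
  assumes "(x, y) \<in> (adj_in G C)\<^sup>*" "y \<in> C"
  shows "\<exists>xs. xs \<noteq> [] \<and> hd xs = x \<and> last xs = y \<and> distinct xs \<and> set xs \<subseteq> C \<and>
           successively (\<lambda>a b. \<exists>e\<in>edges G. ends G e = {a, b}) xs"
  using assms(1)
proof (induction rule: converse_rtrancl_induct)
  case base
  show ?case using assms(2) by (intro exI[of _ "[y]"]) auto
next
  case (step x z)
  then obtain xs where xs: "xs \<noteq> []" "hd xs = z" "last xs = y" "distinct xs" "set xs \<subseteq> C"
    "successively (\<lambda>a b. \<exists>e\<in>edges G. ends G e = {a, b}) xs" by blast
  show ?case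
  proof (cases "x \<in> set xs")
    case True
    then obtain ys zs where "xs = ys @ x # zs" by (meson split_list)
    with xs show ?thesis
      by (intro exI[of _ "x # zs"]) (auto simp: successively_append_iff)
  next
    case False
    with xs step(1) show ?thesis
      by (intro exI[of _ "x # xs"]) (auto simp: successively_Cons adj_in_def)
  qed
qed

text \<open>If \<open>xs\<close> is a single vertex, \<open>e1\<close> and \<open>e2\<close> are
  parallel and form a cycle of length 2; there \<open>e1 \<noteq> e2\<close> is what makes the edge
  list distinct.\<close>

lemma path_closes_to_cycle:
  assumes xs: "xs \<noteq> []" "distinct xs" "set xs \<subseteq> verts G" "v \<in> verts G" "v \<notin> set xs"
    and path: "successively (\<lambda>a b. \<exists>e\<in>edges G. ends G e = {a, b}) xs"
    and e: "e1 \<in> edges G" "e2 \<in> edges G" "e1 \<noteq> e2"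
      "ends G e1 = {v, hd xs}" "ends G e2 = {v, last xs}"
  shows "\<exists>es. is_cycle G (v # xs) es"
proof -
  define n where "n = length xs"
  have n: "n > 0" using xs(1) by (simp add: n_def)
  have "\<exists>e\<in>edges G. ends G e = {xs ! i, xs ! Suc i}" if "Suc i < n" for i
    using path that unfolding successively_conv_nth n_def by blast
  then obtain g where g: "\<And>i. Suc i < n \<Longrightarrow> g i \<in> edges G \<and> ends G (g i) = {xs ! i, xs ! Suc i}"
    by metis
  \<comment> \<open>\<open>f i\<close> leaves position \<open>i\<close> of \<open>v # xs\<close>;
    the shift in \<open>g (i - 1)\<close> accounts for the prepended \<open>v\<close>.\<close>
  define f where "f i = (if i = 0 then e1 else if i = n then e2 else g (i - 1))" for i
  have f_edges: "f i \<in> edges G" if "i \<le> n" for i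
    using that g[of "i - 1"] e by (auto simp: f_def)
  have f_ends: "ends G (f i) = {(v # xs) ! i, (v # xs) ! (Suc i mod Suc n)}" if "i \<le> n" for i
  proof -
    consider "i = 0" | "i = n" "i \<noteq> 0" | "i \<noteq> 0" "i < n" using \<open>i \<le> n\<close> by force
    then show ?thesis
    proof cases
      case 1
      then show ?thesis using e n xs(1) by (simp add: f_def hd_conv_nth)
    next
      case 2
      then show ?thesis using e n xs(1) by (auto simp: f_def last_conv_nth n_def)
    next
      case 3
      then show ?thesis using g[of "i - 1"] by (auto simp: f_def)
    qed
  qed
  have g_nth: "v \<notin> ends G (g i)" if "Suc i < n" for i
    using g[OF that] that xs(5) nth_mem[of i xs] nth_mem[of "Suc i" xs] unfolding n_def by auto
  have g_inj: "i = j" if "g i = g j" "Suc i < n" "Suc j < n" for i j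
  proof -
    have "{xs ! i, xs ! Suc i} = {xs ! j, xs ! Suc j}" using g that by metis
    \<comment> \<open>The crossed matching of the two pairs would give \<open>i = Suc j\<close> and
      \<open>Suc i = j\<close>.\<close>
    then show ?thesis using that xs(2) unfolding n_def
      by (auto simp: doubleton_eq_iff nth_eq_iff_index_eq)
  qed
  have "inj_on f {..n}"
  proof (rule inj_onI)
    fix i j assume ij: "i \<in> {..n}" "j \<in> {..n}" "f i = f j"
    \<comment> \<open>Incidence with \<open>v\<close> separates \<open>e1\<close> and
      \<open>e2\<close> from the edges of the path.\<close>
    have *: "v \<in> ends G (f k) \<longleftrightarrow> k = 0 \<or> k = n" if "k \<le> n" for k
      using that g_nth[of "k - 1"] e by (auto simp: f_def)
    show "i = j"
    proof (cases "i = 0 \<or> i = n")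
      case True
      with *[of i] *[of j] ij have "j = 0 \<or> j = n" by auto
      with True ij e n show ?thesis by (auto simp: f_def split: if_splits)
    next
      case False
      with *[of i] *[of j] ij have "j \<noteq> 0" "j \<noteq> n" by auto
      with False ij g_inj[of "i - 1" "j - 1"] show ?thesis by (auto simp: f_def)
    qed
  qed
  then have "distinct (map f [0..<Suc n])"
    by (simp add: distinct_map atLeast0LessThan lessThan_Suc_atMost del: upt_Suc)
  then have "is_cycle G (v # xs) (map f [0..<Suc n])"
    unfolding is_cycle_def using f_edges f_ends xs
    by (auto simp: n_def less_Suc_eq_le simp del: upt_Suc)
  then show ?thesis ..
qed

text \<open>If \<open>v\<close> were outside \<open>H\<close>, the other ends of \<open>e1\<close>
  and \<open>e2\<close> would lie in \<open>C\<close>. A path between them in \<open>C\<close>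
  closes a cycle through \<open>v\<close> whose remaining vertices are in \<open>H\<close>, so
  convexity forces \<open>v\<close> into \<open>H\<close>.\<close>

lemma cc_convex_absorbs:
  assumes G: "loopless_multigraph G" and H: "cc_convex G H"
    and C: "connected_in G C" "C \<subseteq> H"
    and e: "e1 \<in> edges G" "e2 \<in> edges G" "e1 \<noteq> e2" "v \<in> ends G e1" "v \<in> ends G e2"
      "ends G e1 \<inter> C \<noteq> {}" "ends G e2 \<inter> C \<noteq> {}"
  shows "v \<in> H"
proof (rule ccontr)
  assume v: "v \<notin> H"
  have HV: "H \<subseteq> verts G" using H unfolding cc_convex_def by blast
  obtain x where x: "ends G e1 = {v, x}" "v \<in> verts G"
    by (rule ends_eq_doubleton[OF G e(1,4)])
  obtain y where y: "ends G e2 = {v, y}"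
    by (rule ends_eq_doubleton[OF G e(2,5)])
  have xy: "x \<in> C" "y \<in> C" using v C(2) e x y by auto
  then have "(x, y) \<in> (adj_in G C)\<^sup>*" using C(1) unfolding connected_in_def by blast
  from adj_in_simple_path[OF this xy(2)] obtain xs where
    xs: "xs \<noteq> []" "hd xs = x" "last xs = y" "distinct xs" "set xs \<subseteq> C"
      "successively (\<lambda>a b. \<exists>e\<in>edges G. ends G e = {a, b}) xs" by blast
  have "\<exists>es. is_cycle G (v # xs) es"
    by (rule path_closes_to_cycle[of _ _ _ e1 e2]) (use xs x y e v C HV in auto)
  moreover have "set (v # xs) - H = {v}" using xs C v by auto
  ultimately have "v \<in> cc_interval G H" unfolding cc_interval_def using x by blast
  then show False using H v unfolding cc_convex_def by blast
qed

section \<open>Adding one vertex: merged components and the edge count\<close>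

text \<open>Any two vertices are joined by a route through \<open>v\<close>.\<close>

lemma connected_in_insert_Union:
  assumes "\<And>C. C \<in> \<T> \<Longrightarrow> connected_in G C"
    and "\<And>C. C \<in> \<T> \<Longrightarrow> \<exists>e\<in>edges G. \<exists>x\<in>C. ends G e = {v, x}"
  shows "connected_in G (insert v (\<Union>\<T>))"
proof -
  let ?D = "insert v (\<Union>\<T>)"
  have to_v: "(v, x) \<in> (adj_in G ?D)\<^sup>*" if "x \<in> ?D" for x
  proof (cases "x = v")
    case False
    then obtain C where C: "C \<in> \<T>" "x \<in> C" using \<open>x \<in> ?D\<close> by blast
    then obtain e y where y: "e \<in> edges G" "y \<in> C" "ends G e = {v, y}" using assms(2) by blast
    have "(v, y) \<in> adj_in G ?D" unfolding adj_in_def using y C by blast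
    moreover have "(y, x) \<in> (adj_in G ?D)\<^sup>*"
      using assms(1)[OF C(1)] C y rtrancl_mono[OF adj_in_mono[of C ?D G]]
      unfolding connected_in_def by blast
    ultimately show ?thesis by (rule converse_rtrancl_into_rtrancl)
  qed simp
  have "(x, v) \<in> (adj_in G ?D)\<^sup>*" if "x \<in> ?D" for x
    using to_v[OF that] sym_adj_in[of G ?D] by (meson sym_rtrancl symD)
  with to_v show ?thesis unfolding connected_in_def by (auto intro: rtrancl_trans)
qed

lemma handshake:
  assumes "loopless_multigraph G"
  shows "(\<Sum>v\<in>verts G. degree G v) = 2 * card (edges G)"
proof -
  have fin: "finite (verts G)" "finite (edges G)"
    and ends: "\<And>e. e \<in> edges G \<Longrightarrow> ends G e \<subseteq> verts G \<and> card (ends G e) = 2"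
    using assms unfolding loopless_multigraph_def by auto
  have "(\<Sum>v\<in>verts G. degree G v) = (\<Sum>v\<in>verts G. \<Sum>e\<in>edges G. if v \<in> ends G e then 1 else 0)"
    unfolding degree_def using fin by (simp add: sum.If_cases Int_def)
  also have "\<dots> = (\<Sum>e\<in>edges G. \<Sum>v\<in>verts G. if v \<in> ends G e then 1 else 0)"
    by (rule sum.swap)
  also have "\<dots> = (\<Sum>e\<in>edges G. 2)"
  proof (rule sum.cong)
    fix e assume "e \<in> edges G"
    with ends have "verts G \<inter> ends G e = ends G e" "card (ends G e) = 2" by auto
    then show "(\<Sum>v\<in>verts G. if v \<in> ends G e then 1 else 0) = (2::nat)"
      using fin by (simp add: sum.If_cases)
  qed simp
  finally show ?thesis by simp
qed

text \<open>
  Counting only the components that some edge of \<open>G\<close> leaves makes the bound \<open>3\<close> for the last vertex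
  of a component of \<open>G\<close> and \<open>2\<close> for all others into one uniform inequality: completing a
  component removes it from the count.
\<close>

lemma cc_hull_seed:
  assumes G: "loopless_multigraph G" and deg: "\<And>v. v \<in> verts G \<Longrightarrow> degree G v \<le> 4"
    and "P \<subseteq> verts G"
  shows "\<exists>S \<C>. S \<subseteq> P \<and> P \<subseteq> cc_hull G S \<and> components_of G P \<C> \<and>
    card (edges_within G P) + card {C\<in>\<C>. has_boundary G C} + 2 * card S \<le> 3 * card P"
proof -
  have finV: "finite (verts G)" and finE: "finite (edges G)"
    and ends: "\<And>e. e \<in> edges G \<Longrightarrow> ends G e \<subseteq> verts G \<and> card (ends G e) = 2"
    using G unfolding loopless_multigraph_def by auto
  have "finite P" using assms(3) finV finite_subset by blast
  then show ?thesis using assms(3)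
  proof (induction "card P" arbitrary: P)
    case 0
    then have "P = {}" by simp
    moreover have "edges_within G {} = {}" unfolding edges_within_def using ends by fastforce
    ultimately show ?case
      by (intro exI[of _ "{}"]) (auto simp: components_of_def)
  next
    case (Suc n)
    \<comment> \<open>The order is built from its end: \<open>v\<close> is the last vertex of \<open>P\<close>.\<close>
    obtain v where v: "v \<in> P" and
      v_choice: "has_boundary G P \<Longrightarrow> \<exists>e\<in>edges G. v \<in> ends G e \<and> \<not> ends G e \<subseteq> P"
    proof (cases "has_boundary G P")
      case True
      then show ?thesis using that unfolding has_boundary_def by blast
    next
      case False
      have "P \<noteq> {}" using Suc.hyps(2) by force
      then obtain u where "u \<in> P" by blast
      with False that show ?thesis by blast
    qed
    define Q where "Q = P - {v}"
    have P: "P = insert v Q" "v \<notin> Q" "finite Q"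
      using v Suc.prems by (auto simp: Q_def)
    have cardP: "card P = Suc (card Q)" using P by simp
    have "n = card Q" "Q \<subseteq> verts G" using Suc.hyps(2) cardP Suc.prems by (auto simp: Q_def)
    from Suc.hyps(1)[OF this(1) P(3) this(2)] obtain S \<C> where
      S: "S \<subseteq> Q" "Q \<subseteq> cc_hull G S" and \<C>: "components_of G Q \<C>" and
      le: "card (edges_within G Q) + card {C\<in>\<C>. has_boundary G C} + 2 * card S \<le> 3 * card Q"
      by blast
    have PV: "P \<subseteq> verts G" "v \<in> verts G" using Suc.prems v by auto
    have \<C>D: "\<Union>\<C> = Q" "disjoint \<C>" "\<And>C. C \<in> \<C> \<Longrightarrow> connected_in G C"
      "\<And>e. e \<in> edges_within G Q \<Longrightarrow> \<exists>C\<in>\<C>. ends G e \<subseteq> C"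
      using \<C> unfolding components_of_def by auto
    have fin\<C>: "finite \<C>" using \<C>D(1) P(3) by (simp add: finite_UnionD)
    \<comment> \<open>\<open>B\<close> consists of the edges from \<open>v\<close> back into
      \<open>Q\<close>. The components in \<T> are those touched by \<open>v\<close>; they merge
      with \<open>v\<close> into \<open>D\<close>, and the others stay as they are.\<close>
    define B where "B = {e \<in> edges G. v \<in> ends G e \<and> ends G e \<subseteq> P}"
    define \<T> where "\<T> = {C \<in> \<C>. \<exists>e\<in>edges G. v \<in> ends G e \<and> ends G e \<inter> C \<noteq> {}}"
    define D where "D = insert v (\<Union>\<T>)"
    define \<C>' where "\<C>' = insert D (\<C> - \<T>)"
    have finB: "finite B" using finE by (simp add: B_def)
    have other: "\<exists>x. ends G e = {v, x} \<and> x \<in> Q" if "e \<in> B" for e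
    proof -
      from that have e: "e \<in> edges G" "v \<in> ends G e" "ends G e \<subseteq> P" by (auto simp: B_def)
      obtain x where "ends G e = {v, x}" "x \<noteq> v" by (rule ends_eq_doubleton[OF G e(1,2)])
      then show ?thesis using e(3) P by auto
    qed
    have B_T: "\<exists>C\<in>\<T>. ends G e \<inter> C \<noteq> {} \<and> ends G e \<subseteq> D" if "e \<in> B" for e
    proof -
      obtain x where x: "ends G e = {v, x}" "x \<in> Q" using other[OF \<open>e \<in> B\<close>] by blast
      then obtain C where C: "C \<in> \<C>" "x \<in> C" using \<C>D(1) by blast
      then have "C \<in> \<T>" using x that unfolding \<T>_def B_def by blast
      then show ?thesis using x C unfolding D_def by blast
    qed
    have EP: "edges_within G P = edges_within G Q \<union> B"
      unfolding edges_within_def B_def P(1) by auto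
    have cardE: "card (edges_within G P) = card (edges_within G Q) + card B"
      unfolding EP using P(2) finE
      by (intro card_Un_disjoint) (auto simp: edges_within_def B_def)
    have comps: "components_of G P \<C>'"
    proof -
      have "\<Union>\<C>' = P" using \<C>D(1) P(1) unfolding \<C>'_def D_def \<T>_def by auto
      moreover have "disjoint \<C>'"
        unfolding disjoint_def
      proof (intro ballI impI)
        have *: "D \<inter> A = {}" if "A \<in> \<C> - \<T>" for A
          using that \<C>D(1,2) P(2) unfolding D_def \<T>_def disjoint_def by blast
        fix A A' assume "A \<in> \<C>'" "A' \<in> \<C>'" "A \<noteq> A'"
        then show "A \<inter> A' = {}"
          using * \<C>D(2) unfolding \<C>'_def disjoint_def by blast
      qed
      moreover have "connected_in G D"
        unfolding D_def
      proof (rule connected_in_insert_Union)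
        fix C assume C: "C \<in> \<T>"
        then show "connected_in G C" using \<C>D(3) by (simp add: \<T>_def)
        from C obtain e where e: "e \<in> edges G" "v \<in> ends G e" "ends G e \<inter> C \<noteq> {}"
          and "C \<in> \<C>" by (auto simp: \<T>_def)
        then have "v \<notin> C" using \<C>D(1) P(2) by blast
        obtain x where x: "ends G e = {v, x}" by (rule ends_eq_doubleton[OF G e(1,2)])
        with e(3) \<open>v \<notin> C\<close> have "x \<in> C" by auto
        with e(1) x show "\<exists>e\<in>edges G. \<exists>x\<in>C. ends G e = {v, x}" by (intro bexI[of _ e] bexI[of _ x])
      qed
      moreover have "\<exists>C\<in>\<C>'. ends G e \<subseteq> C" if "e \<in> edges_within G P" for e
      proof (cases "e \<in> B")
        case True
        then show ?thesis using B_T unfolding \<C>'_def by blast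
      next
        case False
        with that EP have "e \<in> edges_within G Q" by auto
        from \<C>D(4)[OF this] obtain C where "C \<in> \<C>" "ends G e \<subseteq> C" by blast
        then show ?thesis unfolding \<C>'_def D_def by (cases "C \<in> \<T>") auto
      qed
      moreover have "\<forall>C\<in>\<C>'. connected_in G C"
        using \<open>connected_in G D\<close> \<C>D(3) unfolding \<C>'_def by blast
      ultimately show ?thesis unfolding components_of_def by blast
    qed
    \<comment> \<open>Each touched component has an edge to \<open>v\<close>, which lies outside
      \<open>Q\<close>. So all of \<T> was counted before and leaves the count on merging.\<close>
    have T_open: "\<T> \<subseteq> {C\<in>\<C>. has_boundary G C}"
      using \<C>D(1) P(2) unfolding \<T>_def has_boundary_def by blast
    have finT: "finite \<T>" using fin\<C> by (simp add: \<T>_def)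
    \<comment> \<open>\<delta> bounds the contribution of \<open>D\<close> to the new count. When it
      is 1, the choice of \<open>v\<close> provides an edge at \<open>v\<close> leaving
      \<open>P\<close>, whence \<open>card B + \<delta> \<le> 4\<close> below.\<close>
    define \<delta> where "\<delta> = (if has_boundary G P then 1 else 0 :: nat)"
    have "{C\<in>\<C>'. has_boundary G C} \<subseteq>
        ({C\<in>\<C>. has_boundary G C} - \<T>) \<union> (if has_boundary G P then {D} else {})"
    proof -
      \<comment> \<open>If no edge leaves \<open>P\<close>, an edge meeting \<open>D\<close> lies in
        a single member of the new family, and by disjointness that member is
        \<open>D\<close>.\<close>
      have "\<not> has_boundary G D" if "\<not> has_boundary G P"
      proof
        assume "has_boundary G D"
        then obtain e where e: "e \<in> edges G" "ends G e \<inter> D \<noteq> {}" "\<not> ends G e \<subseteq> D"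
          unfolding has_boundary_def by blast
        have "D \<subseteq> P" using comps unfolding components_of_def \<C>'_def by blast
        then have "e \<in> edges_within G P"
          using that e unfolding has_boundary_def edges_within_def by blast
        then obtain C where "C \<in> \<C>'" "ends G e \<subseteq> C"
          using comps unfolding components_of_def by blast
        moreover have "C = D"
          using comps calculation e unfolding components_of_def \<C>'_def disjoint_def by blast
        ultimately show False using e by blast
      qed
      then show ?thesis unfolding \<C>'_def by auto
    qed
    then have "card {C\<in>\<C>'. has_boundary G C} \<le>
        card (({C\<in>\<C>. has_boundary G C} - \<T>) \<union> (if has_boundary G P then {D} else {}))"
      using fin\<C> by (intro card_mono) auto
    also have "\<dots> \<le> card ({C\<in>\<C>. has_boundary G C} - \<T>) + card (if has_boundary G P then {D} else {})"
      by (rule card_Un_le)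
    also have "\<dots> = card {C\<in>\<C>. has_boundary G C} - card \<T> + \<delta>"
      using T_open finT by (simp add: card_Diff_subset \<delta>_def)
    finally have open': "card {C\<in>\<C>'. has_boundary G C} + card \<T> \<le>
        card {C\<in>\<C>. has_boundary G C} + \<delta>"
      using card_mono[OF _ T_open] fin\<C> by simp
    have SV: "S \<subseteq> verts G" using S P PV by blast
    note hull = cc_hull_least[OF SV]
    show ?case
    proof (cases "card B \<le> card \<T>")
      \<comment> \<open>Here \<open>v\<close> joins \<open>S\<close>. The left side grows by at most
        \<open>card B - card \<T> + \<delta> + 2\<close>, hence by at most 3, while
        \<open>3 * card P\<close> exceeds \<open>3 * card Q\<close> by exactly 3.\<close>
      case True
      have "insert v S \<subseteq> P" using S P by blast
      moreover have "P \<subseteq> cc_hull G (insert v S)"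
      proof -
        have "cc_hull G S \<subseteq> cc_hull G (insert v S)"
          unfolding cc_hull_def by (rule hull_mono) blast
        moreover have "v \<in> cc_hull G (insert v S)"
          unfolding cc_hull_def by (rule hull_inc) simp
        ultimately show ?thesis using S P by blast
      qed
      moreover have "card (insert v S) \<le> Suc (card S)" by (rule card_insert_le_m1) auto
      ultimately show ?thesis
        using comps True open' cardE cardP le
        by (intro exI[of _ "insert v S"] exI[of _ \<C>']) (auto simp: \<delta>_def split: if_splits)
    next
      case False
      \<comment> \<open>Pigeonhole: with more back edges than touched components, two of them enter
        the same component, so \<open>v\<close> is absorbed and \<open>S\<close> stays
        unchanged.\<close>
      obtain c where c: "\<And>e. e \<in> B \<Longrightarrow> c e \<in> \<T> \<and> ends G e \<inter> c e \<noteq> {}"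
        using B_T by metis
      have "\<not> inj_on c B"
        using False c card_inj_on_le[of c B \<T>] finT by blast
      then obtain e1 e2 where e12: "e1 \<in> B" "e2 \<in> B" "e1 \<noteq> e2" "c e1 = c e2"
        unfolding inj_on_def by blast
      have "c e1 \<in> \<C>" using c[OF e12(1)] by (simp add: \<T>_def)
      then have "connected_in G (c e1)" "c e1 \<subseteq> cc_hull G S"
        using \<C>D(1,3) S by auto
      then have "v \<in> cc_hull G S"
        using cc_convex_absorbs[OF G hull(1), of "c e1" e1 e2 v] e12 c[of e1] c[of e2]
        by (auto simp: B_def)
      then have "P \<subseteq> cc_hull G S" using S P by blast
      moreover have "S \<subseteq> P" using S P by blast
      \<comment> \<open>With \<open>card B + \<delta> \<le> 4\<close> the growth
        \<open>card B + \<delta> - card \<T>\<close> is again at most 3.\<close>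
      moreover have "card \<T> \<ge> 1" using c[OF e12(1)] finT by (auto simp: Suc_le_eq card_gt_0_iff)
      moreover have "card B + \<delta> \<le> 4"
      proof -
        let ?I = "{e \<in> edges G. v \<in> ends G e}"
        have "card B + \<delta> \<le> card ?I"
        proof (cases "has_boundary G P")
          case True
          with v_choice have "B \<subset> ?I" unfolding B_def by blast
          then show ?thesis using psubset_card_mono[of ?I B] finE True by (simp add: \<delta>_def)
        next
          case False
          then show ?thesis using finE by (auto simp: \<delta>_def B_def intro: card_mono)
        qed
        then show ?thesis using deg[OF PV(2)] by (simp add: degree_def)
      qed
      ultimately show ?thesis
        using comps open' cardE cardP le
        by (intro exI[of _ S] exI[of _ \<C>']) auto
    qed
  qed
qed

text \<open>With all vertices as \<open>P\<close>, handshaking gives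
  \<open>card (edges G) = 2 * card (verts G)\<close>, and the inequality for the seed leaves
  \<open>2 * card S \<le> card (verts G)\<close>.\<close>

lemma cc_hull_number_le_half:
  assumes G: "loopless_multigraph G" and reg: "regular 4 G"
  shows "2 * cc_hull_number G \<le> card (verts G)"
proof -
  have finV: "finite (verts G)" and ends: "\<And>e. e \<in> edges G \<Longrightarrow> ends G e \<subseteq> verts G"
    using G unfolding loopless_multigraph_def by auto
  obtain S \<C> where S: "S \<subseteq> verts G" "verts G \<subseteq> cc_hull G S"
    and le: "card (edges_within G (verts G)) + card {C\<in>\<C>. has_boundary G C} + 2 * card S
      \<le> 3 * card (verts G)"
    using cc_hull_seed[OF G, of "verts G"] reg unfolding regular_def by auto
  have "edges_within G (verts G) = edges G" using ends unfolding edges_within_def by auto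
  moreover have "2 * card (edges G) = 4 * card (verts G)"
    using handshake[OF G] reg unfolding regular_def by simp
  ultimately have "2 * card S \<le> card (verts G)" using le by simp
  moreover have "cc_hull_set G S"
    using S cc_hull_least(3)[OF S(1) cc_convex_verts S(1)] unfolding cc_hull_set_def by blast
  ultimately show ?thesis using cc_hull_number_attained(2)[OF finV] by fastforce
qed

section \<open>Tightness: two vertices joined by parallel edges\<close>

definition dipole :: "nat \<Rightarrow> (nat, nat) multigraph" where
  "dipole k = \<lparr>verts = {0, 1}, edges = {..<k}, ends = (\<lambda>_. {0, 1})\<rparr>"

lemma loopless_dipole: "loopless_multigraph (dipole k)"
  unfolding loopless_multigraph_def dipole_def by auto

lemma regular_dipole: "regular k (dipole k)"
  unfolding regular_def degree_def dipole_def by (auto simp: lessThan_def)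

lemma planar_dipole: "planar (dipole k)"
proof -
  \<comment> \<open>Edge \<open>j\<close> is the graph of \<open>j * t * (1 - t)\<close> over the
    unit interval (a segment for \<open>j = 0\<close>); for different \<open>j\<close> these curves
    agree only at the ends 0 and 1.\<close>
  define \<gamma> where "\<gamma> j t = Complex t (real j * (t * (1 - t)))" for j :: nat and t
  have path: "path (\<gamma> j)" for j
    unfolding path_def \<gamma>_def Complex_eq by (intro continuous_intros)
  have "arc (\<gamma> j)" for j
    using path unfolding arc_def by (auto simp: \<gamma>_def inj_on_def)
  moreover have "path_image (\<gamma> i) \<inter> path_image (\<gamma> j) \<subseteq> {0, 1}" if "i \<noteq> j" for i j
    using that by (auto simp: path_image_def \<gamma>_def complex_eq_iff)
  moreover have "pathstart (\<gamma> j) = 0" "pathfinish (\<gamma> j) = 1" for j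
    by (auto simp: \<gamma>_def pathstart_def pathfinish_def complex_eq_iff)
  ultimately have "plane_drawing (dipole k) of_nat \<gamma>"
    unfolding plane_drawing_def dipole_def by auto
  then show ?thesis unfolding planar_def by blast
qed

text \<open>A cycle on a single vertex would be a loop, so the empty set is convex and is its own
  hull.\<close>

lemma cc_hull_number_pos:
  assumes "loopless_multigraph G" "verts G \<noteq> {}"
  shows "cc_hull_number G > 0"
proof (rule ccontr)
  assume "\<not> ?thesis"
  moreover have finV: "finite (verts G)" using assms(1) unfolding loopless_multigraph_def by blast
  ultimately obtain S where S: "cc_hull_set G S" "card S = 0"
    using cc_hull_number_attained(1)[of G] by auto
  then have "S = {}" using finite_subset[OF _ finV] unfolding cc_hull_set_def by auto
  have "\<not> (\<exists>v vs es. is_cycle G vs es \<and> set vs = {v})"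
  proof
    assume "\<exists>v vs es. is_cycle G vs es \<and> set vs = {v}"
    then obtain v vs es where c: "is_cycle G vs es" and "set vs = {v}" by blast
    moreover from this have "length vs = 1"
      unfolding is_cycle_def
      by (metis card.empty card_insert_disjoint distinct_card empty_iff finite.emptyI One_nat_def)
    ultimately have "es ! 0 \<in> edges G" "ends G (es ! 0) = {v}"
      unfolding is_cycle_def by (auto simp: length_Suc_conv)
    then show False using assms(1) unfolding loopless_multigraph_def by force
  qed
  then have "cc_convex G {}" unfolding cc_convex_def cc_interval_def by auto
  then have "cc_hull G S = {}" unfolding cc_hull_def \<open>S = {}\<close> by (rule hull_same)
  then show False using S assms(2) unfolding cc_hull_set_def by simp
qed

text \<open>The condition \<open>verts G \<noteq> {}\<close> keeps the empty graph, where both sides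
  are 0, from serving as the witness of tightness.\<close>

theorem theorem4:
  "(\<forall>G :: ('v, 'e) multigraph.
      loopless_multigraph G \<and> regular 4 G \<and> planar G \<longrightarrow>
        real (cc_hull_number G) \<le> 1 / 2 * real (card (verts G))) \<and>
   (\<exists>G :: (nat, nat) multigraph.
      loopless_multigraph G \<and> verts G \<noteq> {} \<and> regular 4 G \<and> planar G \<and>
        real (cc_hull_number G) = 1 / 2 * real (card (verts G)))"
proof (intro conjI allI impI)
  fix G :: "('v, 'e) multigraph"
  assume "loopless_multigraph G \<and> regular 4 G \<and> planar G"
  then have "2 * cc_hull_number G \<le> card (verts G)" using cc_hull_number_le_half by blast
  then show "real (cc_hull_number G) \<le> 1 / 2 * real (card (verts G))" by linarith
next
  have verts: "verts (dipole 4) = {0, 1}" by (simp add: dipole_def)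
  \<comment> \<open>The general bound and positivity pin the hull number to 1, half of the two
    vertices.\<close>
  have "2 * cc_hull_number (dipole 4) \<le> 2"
    using cc_hull_number_le_half[OF loopless_dipole regular_dipole] verts by simp
  moreover have "cc_hull_number (dipole 4) > 0"
    using verts by (intro cc_hull_number_pos loopless_dipole) simp
  ultimately have "real (cc_hull_number (dipole 4)) = 1 / 2 * real (card (verts (dipole 4)))"
    using verts by simp
  then show "\<exists>G :: (nat, nat) multigraph.
      loopless_multigraph G \<and> verts G \<noteq> {} \<and> regular 4 G \<and> planar G \<and>
        real (cc_hull_number G) = 1 / 2 * real (card (verts G))"
    using loopless_dipole[of 4] regular_dipole[of 4] planar_dipole[of 4] verts by blast
qed

end
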